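(* Suppose the standing assumption in the context holds and the algorithm in the context does not terminate finitely. Let $x_*$ be a first-order KKT point of the problem $\min_{x\in\mathbb{R}^n} f(x)+r(x)$ subject to $c(x)=0$, $x\in\Omega$, with Lagrange multiplier vectors $y_*$ and $z_*$, and suppose that $r$ is convex and partly smooth at $x_*$ relative to a $C^2$-smooth manifold $\mathcal{M}$. Assume that the proximal parameter sequence $\{\alpha_k\}_{k\in\mathbb{N}}$ is bounded away from zero, that there exists an infinite index set $\mathcal{S}_1\subseteq\mathcal{S}$ such that $\{(x_k,s_k,y_k,z_k)\}_{k\in\mathcal{S}_1}\to(x_*,0,y_*,z_* )$, and that the non-degeneracy condition $$0\in\{g(x_* )+J(x_* )^Ty_*+z_*\}+\mathrm{relint}(\partial r(x_* ))$$ holds, where $\mathrm{relint}$ denotes the relative interior of a convex set. Then $x_{k+1}\in\mathcal{M}$ for all sufficiently large $k\in\mathcal{S}_1$.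
   Context: Problem and notation. Consider $\min_{x\in\mathbb{R}^n} f(x)+r(x)$ subject to $c(x)=0$, $x\in\Omega$, where $f:\mathbb{R}^n\to\mathbb{R}$ and $c:\mathbb{R}^n\to\mathbb{R}^m$ ($m\le n$) are continuously differentiable, $r:\mathbb{R}^n\to[0,\infty)$ is convex (possibly nonsmooth), and $\Omega=\{x\in\mathbb{R}^n: x\ge0\}$. Let $g=\nabla f$ and $J(x)=\nabla c(x)^T\in\mathbb{R}^{m\times n}$ (the Jacobian); $f_k,r_k,g_k,c_k,J_k$ denote values at $x_k$; $\mathbb{N}=\{0,1,2,\dots\}$; minima/maxima of vectors are componentwise; $\mathrm{Proj}_C$ is Euclidean projection onto $C$; $T_\Omega(x)$ is the tangent cone of $\Omega$ at $x$. A point $x$ is a first-order KKT point with multipliers $(y,z)\in\mathbb{R}^m\times\mathbb{R}^n$ if there exists $g_r\in\partial r(x)$ with $g(x)+g_r+J(x)^Ty+z=0$, $c(x)=0$, $\min\{x,-z\}=0$. Algorithm. Inputs: $x_0\in\Omega$, $\alpha_0,\tau_{-1},\kappa_v>0$, and $\xi,\eta_\Phi,\sigma_c,\epsilon_\tau,\gamma,\eta_m\in(0,1)$. For $k=0,1,2,\dots$: (1) Let $\delta_k=\|\mathrm{Proj}_{T_\Omega(x_k)}(-J_k^Tc_k)\|_2$, $m_k(v)=\frac12\|c_k+J_kv\|_2^2$, and $v_k(\beta)=\mathrm{Proj}_\Omega(x_k-\beta J_k^Tc_k)-x_k$ for $\beta>0$. The Cauchy point is $v_k^c=v_k(\beta_k)$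 with $\beta_k=\gamma^{i_k}$, where $i_k$ is the smallest nonnegative integer such that $\|v_k(\beta_k)\|_2\le\kappa_v\alpha_k\delta_k$ and $m_k(v_k(\beta_k))\le m_k(0)+\eta_m\nabla m_k(0)^Tv_k(\beta_k)$. (2) If $\delta_k=0$, set $v_k=0$ and, if additionally $c_k\ne0$, terminate returning $x_k$. If $\delta_k\neq0$, let $v_k$ be any vector with $\|v_k\|_2\le\kappa_v\alpha_k\delta_k$, $x_k+v_k\in\Omega$, and $m_k(v_k)\le m_k(v_k^c)$. (3) Let $u_k$ be the unique minimizer of $g_k^Tu+\frac{1}{2\alpha_k}\|u\|_2^2+\frac1{\alpha_k}v_k^Tu+r(x_k+v_k+u)$ over $u\in\mathbb{R}^n$ with $J_ku=0$, $x_k+v_k+u\in\Omega$; set $s_k=v_k+u_k$. Let $g_{r,k}\in\partial r(x_k+v_k+u_k)$, $y_k\in\mathbb{R}^m$, $z_k\in\mathbb{R}^n$ satisfy the optimality conditions $g_k+\frac1{\alpha_k}u_k+\frac1{\alpha_k}v_k+g_{r,k}+J_k^Ty_k+z_k=0$, $J_ku_k=0$, $\min\{x_k+v_k+u_k,-z_k\}=0$ (such quantities exist). (4) If $s_k=0$, terminate returning $x_k$. (5) Let $A_k=g_k^Ts_k+\frac1{2\alpha_k}\|s_k\|_2^2+r(x_k+s_k)-r_k$; $\tau_{k,\mathrm{trial}}=\infty$ if $A_k\le0$ and $\tau_{k,\mathrm{trial}}=(1-\sigma_c)(\|c_k\|_2-\|c_k+J_ks_k\|_2)/A_k$ otherwise;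 $\tau_k=\tau_{k-1}$ if $\tau_{k-1}\le\tau_{k,\mathrm{trial}}$ and $\tau_k=\min\{(1-\epsilon_\tau)\tau_{k-1},\tau_{k,\mathrm{trial}}\}$ otherwise. (6) With $\Phi_\tau(x)=\tau(f(x)+r(x))+\|c(x)\|_2$: if $\Phi_{\tau_k}(x_k+s_k)-\Phi_{\tau_k}(x_k)\le-\eta_\Phi\left(\frac{\tau_k}{4\alpha_k}\|s_k\|_2^2+\sigma_c(\|c_k\|_2-\|c_k+J_ks_k\|_2)\right)$, set $x_{k+1}=x_k+s_k$, $\alpha_{k+1}=\alpha_k$; otherwise set $x_{k+1}=x_k$, $\alpha_{k+1}=\xi\alpha_k$. $\mathcal{S}=\{k\in\mathbb{N}:x_{k+1}=x_k+s_k\}$ is the set of successful iterations. Standing assumption. There is an open convex set $\mathcal{X}\subseteq\mathbb{R}^n$ containing all $x_k$ and $x_k+v_k$ such that, over $\mathcal{X}$, $f$ and each $c_i$ are bounded, $\nabla f$ and each $\nabla c_i$ are Lipschitz continuous and bounded in norm, and $\partial r$ is bounded. Partial smoothness. A set $\mathcal{M}\subset\mathbb{R}^n$ is a $C^2$-smooth manifold around $\bar x\in\mathcal{M}$ if there is a $C^2$ map $F$ from a neighborhood of $\bar x$ into some $\mathbb{R}^p$ with surjective derivative at $\bar x$ such that, for all $x$ near $\bar x$, $x\in\mathcal{M}$ if and only if $F(x)=0$; the normal space $N_{\mathcal{M}}(\bar x)$ is the range of $\nabla F(\bar x)^{*}$ (adjoint of the derivative). A function $h$ is partly smooth at $\bar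 x$ relative to $\mathcal{M}\ni\bar x$ if $\mathcal{M}$ is a $C^2$-smooth manifold around $\bar x$ and: (restricted smoothness) $h|_{\mathcal{M}}$ is $C^2$ around $\bar x$; (regularity) at every point of $\mathcal{M}$ near $\bar x$, $h$ is subdifferentially regular and has a subgradient; (normal sharpness) the affine span of $\partial h(\bar x)$ is a translate of $N_{\mathcal{M}}(\bar x)$; (subgradient continuity) the set-valued map $\partial h$ restricted to $\mathcal{M}$ is continuous at $\bar x$. *)

theory Defs
  imports "HOL-Analysis.Analysis"
begin

section \<open>Variational analysis\<close>

text \<open>Subdifferential in the sense of convex analysis.\<close>

definition subdifferential :: "('a::euclidean_space \<Rightarrow> real) \<Rightarrow> 'a \<Rightarrow> 'a set" where
  "subdifferential h x = {v. \<forall>y. h x + v \<bullet> (y - x) \<le> h y}"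

text \<open>Bouligand (contingent) tangent cone.\<close>

definition tangent_cone :: "'a::euclidean_space set \<Rightarrow> 'a \<Rightarrow> 'a set" where
  "tangent_cone S x = {d. \<exists>(w :: nat \<Rightarrow> 'a) (t :: nat \<Rightarrow> real).
     (\<forall>k. w k \<in> S \<and> 0 < t k) \<and> w \<longlonglongrightarrow> x \<and> t \<longlonglongrightarrow> 0 \<and>
     (\<lambda>k. (w k - x) /\<^sub>R t k) \<longlonglongrightarrow> d}"

text \<open>
  Partial smoothness is a notion for not necessarily convex functions, so its subdifferential is
  the limiting one and its regularity is Clarke regularity of the epigraph
  (Rockafellar and Wets, Variational Analysis, Definitions 6.3, 6.4, 7.25 and Theorem 8.9).
\<close>

definition regular_normal_cone :: "'a::euclidean_space set \<Rightarrow> 'a \<Rightarrow> 'a set" where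
  "regular_normal_cone S x =
     {v. \<forall>e>0. \<forall>\<^sub>F y in at x within S. v \<bullet> (y - x) \<le> e * norm (y - x)}"

definition normal_cone :: "'a::euclidean_space set \<Rightarrow> 'a \<Rightarrow> 'a set" where
  "normal_cone S x = {v. \<exists>(w :: nat \<Rightarrow> 'a) (n :: nat \<Rightarrow> 'a).
     (\<forall>k. w k \<in> S \<and> n k \<in> regular_normal_cone S (w k)) \<and> w \<longlonglongrightarrow> x \<and> n \<longlonglongrightarrow> v}"

definition clarke_regular :: "'a::euclidean_space set \<Rightarrow> 'a \<Rightarrow> bool" where
  "clarke_regular S x \<longleftrightarrow> x \<in> S \<and> (\<exists>e>0. closed (S \<inter> cball x e)) \<and>
     normal_cone S x = regular_normal_cone S x"

definition limiting_subdifferential :: "('a::euclidean_space \<Rightarrow> real) \<Rightarrow> 'a \<Rightarrow> 'a set" where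
  "limiting_subdifferential h x = {v. (v, -1) \<in> normal_cone (epigraph UNIV h) (x, h x)}"

definition subdifferentially_regular :: "('a::euclidean_space \<Rightarrow> real) \<Rightarrow> 'a \<Rightarrow> bool" where
  "subdifferentially_regular h x \<longleftrightarrow> clarke_regular (epigraph UNIV h) (x, h x)"

lemma regular_normal_cone_convex:
  fixes S :: "'a::euclidean_space set"
  assumes "convex S" "x \<in> S"
  shows "regular_normal_cone S x = {v. \<forall>y\<in>S. v \<bullet> (y - x) \<le> 0}"
proof (intro set_eqI iffI)
  fix v assume v: "v \<in> regular_normal_cone S x"
  have "v \<bullet> (y - x) \<le> 0" if y: "y \<in> S" for y
  proof (cases "y = x")
    case False
    have "v \<bullet> (y - x) \<le> e * norm (y - x)" if e: "e > 0" for e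
    proof -
      have "\<forall>\<^sub>F w in at x within S. v \<bullet> (w - x) \<le> e * norm (w - x)"
        using v e by (auto simp: regular_normal_cone_def)
      then obtain d where d: "d > 0"
        "\<And>w. w \<in> S \<Longrightarrow> w \<noteq> x \<Longrightarrow> dist w x < d \<Longrightarrow> v \<bullet> (w - x) \<le> e * norm (w - x)"
        unfolding eventually_at by blast
      define t where "t = min 1 (d / (2 * norm (y - x)))"
      have t: "0 < t" "t \<le> 1" "t * norm (y - x) < d"
        using False d(1) by (auto simp: t_def min_def field_simps)
      define w where "w = x + t *\<^sub>R (y - x)"
      have "w = (1 - t) *\<^sub>R x + t *\<^sub>R y" by (simp add: w_def algebra_simps)
      then have "w \<in> S" using assms y t by (simp add: convexD)
      moreover have "w \<noteq> x" "dist w x < d" using False t by (auto simp: w_def dist_norm)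
      ultimately have "v \<bullet> (w - x) \<le> e * norm (w - x)" using d(2) by blast
      then have "t * (v \<bullet> (y - x)) \<le> t * (e * norm (y - x))" using t by (simp add: w_def ac_simps)
      then show ?thesis using t by (simp add: mult_le_cancel_left_pos)
    qed
    then have "v \<bullet> (y - x) \<le> 0 + e" if "e > 0" for e
      using False that by (metis add_0 divide_pos_pos nonzero_eq_divide_eq norm_eq_zero
          right_minus_eq zero_less_norm_iff)
    then show ?thesis by (meson field_le_epsilon)
  qed simp
  then show "v \<in> {v. \<forall>y\<in>S. v \<bullet> (y - x) \<le> 0}" by blast
next
  fix v assume "v \<in> {v. \<forall>y\<in>S. v \<bullet> (y - x) \<le> 0}"
  then have "v \<bullet> (y - x) \<le> e * norm (y - x)" if "e > 0" "y \<in> S" for e y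
    using that by (smt (verit) mem_Collect_eq mult_nonneg_nonneg norm_ge_zero)
  then show "v \<in> regular_normal_cone S x"
    unfolding regular_normal_cone_def eventually_at_filter by (auto intro: always_eventually)
qed

lemma normal_cone_convex:
  fixes S :: "'a::euclidean_space set"
  assumes "convex S" "x \<in> S"
  shows "normal_cone S x = {v. \<forall>y\<in>S. v \<bullet> (y - x) \<le> 0}"
proof (intro set_eqI iffI)
  fix v assume "v \<in> normal_cone S x"
  then obtain w n where wn: "\<And>k::nat. w k \<in> S" "\<And>k. n k \<in> regular_normal_cone S (w k)"
    "w \<longlonglongrightarrow> x" "n \<longlonglongrightarrow> v"
    by (auto simp: normal_cone_def)
  have "v \<bullet> (y - x) \<le> 0" if "y \<in> S" for y
  proof (rule LIMSEQ_le_const2)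
    show "(\<lambda>k. n k \<bullet> (y - w k)) \<longlonglongrightarrow> v \<bullet> (y - x)"
      using wn by (intro tendsto_intros)
    show "\<exists>N. \<forall>k\<ge>N. n k \<bullet> (y - w k) \<le> 0"
      using wn(1,2) that regular_normal_cone_convex[OF assms(1)] by blast
  qed
  then show "v \<in> {v. \<forall>y\<in>S. v \<bullet> (y - x) \<le> 0}" by blast
next
  fix v assume "v \<in> {v. \<forall>y\<in>S. v \<bullet> (y - x) \<le> 0}"
  then have "v \<in> regular_normal_cone S x" by (simp add: regular_normal_cone_convex[OF assms])
  then show "v \<in> normal_cone S x"
    unfolding normal_cone_def mem_Collect_eq using assms(2)
    by (intro exI[of _ "\<lambda>_. x"] exI[of _ "\<lambda>_. v"]) simp
qed

text \<open>For convex functions the limiting subdifferential is the one of convex analysis.\<close>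

lemma limiting_subdifferential_convex:
  fixes h :: "'a::euclidean_space \<Rightarrow> real"
  assumes "convex_on UNIV h"
  shows "limiting_subdifferential h x = subdifferential h x"
proof -
  have "convex (epigraph UNIV h)" using assms convex_epigraph by blast
  moreover have "(x, h x) \<in> epigraph UNIV h" by (simp add: epigraph_def)
  ultimately have *: "limiting_subdifferential h x =
      {v. \<forall>p \<in> epigraph UNIV h. (v, -1) \<bullet> (p - (x, h x)) \<le> 0}"
    by (simp add: limiting_subdifferential_def normal_cone_convex)
  have "(\<forall>p \<in> epigraph UNIV h. (v, -1) \<bullet> (p - (x, h x)) \<le> 0) \<longleftrightarrow>
      (\<forall>y. h x + v \<bullet> (y - x) \<le> h y)"
    (is "?L \<longleftrightarrow> ?R") for v
  proof
    assume L: ?L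
    show ?R
    proof
      fix y
      have "(y, h y) \<in> epigraph UNIV h" by (simp add: epigraph_def)
      with L have "(v, -1) \<bullet> ((y, h y) - (x, h x)) \<le> 0" by blast
      then show "h x + v \<bullet> (y - x) \<le> h y" by simp
    qed
  next
    assume R: ?R
    show ?L
    proof
      fix p assume "p \<in> epigraph UNIV h"
      then have "h (fst p) \<le> snd p" by (simp add: epigraph_def)
      moreover have "h x + v \<bullet> (fst p - x) \<le> h (fst p)" using R by blast
      ultimately show "(v, -1) \<bullet> (p - (x, h x)) \<le> 0" by (cases p) simp
    qed
  qed
  then show ?thesis by (simp add: * subdifferential_def)
qed

text \<open>
  Continuity of a set-valued map at a point relative to a set, in the sense of Painleve and
  Kuratowski: outer and inner semicontinuity.
\<close>

definition setvalued_continuous_within ::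
  "('a::euclidean_space \<Rightarrow> 'b::euclidean_space set) \<Rightarrow> 'a set \<Rightarrow> 'a \<Rightarrow> bool" where
  "setvalued_continuous_within T M x \<longleftrightarrow>
     (\<forall>(w :: nat \<Rightarrow> 'a) (q :: nat \<Rightarrow> 'b) a.
        (\<forall>k. w k \<in> M \<and> q k \<in> T (w k)) \<and> w \<longlonglongrightarrow> x \<and> q \<longlonglongrightarrow> a \<longrightarrow> a \<in> T x) \<and>
     (\<forall>(w :: nat \<Rightarrow> 'a). \<forall>a \<in> T x. (\<forall>k. w k \<in> M) \<and> w \<longlonglongrightarrow> x \<longrightarrow>
        (\<exists>q :: nat \<Rightarrow> 'b. (\<forall>\<^sub>F k in sequentially. q k \<in> T (w k)) \<and> q \<longlonglongrightarrow> a))"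

section \<open>Smooth manifolds and partial smoothness\<close>

definition C2_on :: "('a::euclidean_space \<Rightarrow> 'b::euclidean_space) \<Rightarrow> 'a set \<Rightarrow> bool" where
  "C2_on F U \<longleftrightarrow> open U \<and>
     (\<exists>(F' :: 'a \<Rightarrow> ('a \<Rightarrow>\<^sub>L 'b)) (F'' :: 'a \<Rightarrow> ('a \<Rightarrow>\<^sub>L ('a \<Rightarrow>\<^sub>L 'b))).
        (\<forall>x\<in>U. (F has_derivative blinfun_apply (F' x)) (at x)) \<and>
        (\<forall>x\<in>U. (F' has_derivative blinfun_apply (F'' x)) (at x)) \<and>
        continuous_on U F'')"

text \<open>
  A map into \<open>\<real>\<^sup>p\<close> whose derivative \<open>D\<close> at \<open>x\<close> is surjective exists only for \<open>p \<le> DIM('a)\<close>.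
  Since \<open>p\<close> is existentially quantified, \<open>\<real>\<^sup>p\<close> is represented by a subspace \<open>V\<close> of the ambient
  space, with \<open>p = dim V\<close>.
\<close>

definition local_defining_map ::
  "'a::euclidean_space set \<Rightarrow> 'a \<Rightarrow> ('a \<Rightarrow> 'a) \<Rightarrow> ('a \<Rightarrow> 'a) \<Rightarrow> bool" where
  "local_defining_map M x F D \<longleftrightarrow>
     (\<exists>U V. x \<in> U \<and> C2_on F U \<and> subspace V \<and> F ` U \<subseteq> V \<and>
        (F has_derivative D) (at x) \<and> range D = V \<and> (\<forall>y\<in>U. y \<in> M \<longleftrightarrow> F y = 0))"

definition C2_manifold_around :: "'a::euclidean_space set \<Rightarrow> 'a \<Rightarrow> bool" where
  "C2_manifold_around M x \<longleftrightarrow> x \<in> M \<and> (\<exists>F D. local_defining_map M x F D)"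

text \<open>
  The adjoint of \<open>D\<close> vanishes on the orthogonal complement of \<open>V = range D\<close>, so its range is that
  of the adjoint of \<open>D\<close> regarded as a map into \<open>V\<close>.
\<close>

definition is_normal_space :: "'a::euclidean_space set \<Rightarrow> 'a \<Rightarrow> 'a set \<Rightarrow> bool" where
  "is_normal_space M x N \<longleftrightarrow> (\<exists>F D. local_defining_map M x F D \<and> N = range (adjoint D))"

definition partly_smooth :: "('a::euclidean_space \<Rightarrow> real) \<Rightarrow> 'a \<Rightarrow> 'a set \<Rightarrow> bool" where
  "partly_smooth h x M \<longleftrightarrow>
     C2_manifold_around M x \<and>
     (\<exists>U \<phi>. x \<in> U \<and> C2_on \<phi> U \<and> (\<forall>y \<in> M \<inter> U. h y = \<phi> y)) \<and>
     (\<exists>e>0. \<forall>y \<in> M \<inter> ball x e.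
        subdifferentially_regular h y \<and> limiting_subdifferential h y \<noteq> {}) \<and>
     (\<exists>N a. is_normal_space M x N \<and>
        affine hull (limiting_subdifferential h x) = (\<lambda>w. a + w) ` N) \<and>
     setvalued_continuous_within (limiting_subdifferential h) M x"

section \<open>The problem\<close>

definition nonneg_orthant :: "(real^'n) set" where
  "nonneg_orthant = {x. \<forall>i. 0 \<le> x $ i}"

definition complementary :: "real^'n \<Rightarrow> real^'n \<Rightarrow> bool" where
  "complementary x z \<longleftrightarrow> (\<forall>i. min (x $ i) (- (z $ i)) = 0)"

text \<open>\<open>g\<close> is the gradient of \<open>f\<close>, and \<open>J\<close> is the Jacobian of \<open>c\<close>.\<close>

locale nonsmooth_nlp =
  fixes f :: "real^'n \<Rightarrow> real"
    and g :: "real^'n \<Rightarrow> real^'n"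
    and c :: "real^'n \<Rightarrow> real^'m"
    and J :: "real^'n \<Rightarrow> real^'n^'m"
    and r :: "real^'n \<Rightarrow> real"
  assumes dim_le: "CARD('m) \<le> CARD('n)"
    and f_grad: "\<And>x. GDERIV f x :> g x"
    and g_cont: "continuous_on UNIV g"
    and c_jac: "\<And>x. (c has_derivative (\<lambda>d. J x *v d)) (at x)"
    and J_cont: "continuous_on UNIV J"
    and r_convex: "convex_on UNIV r"
    and r_nonneg: "\<And>x. 0 \<le> r x"
begin

definition kkt_point :: "real^'n \<Rightarrow> real^'m \<Rightarrow> real^'n \<Rightarrow> bool" where
  "kkt_point x y z \<longleftrightarrow>
     (\<exists>g\<^sub>r \<in> subdifferential r x. g x + g\<^sub>r + transpose (J x) *v y + z = 0) \<and>
     c x = 0 \<and> complementary x z"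

definition merit :: "real \<Rightarrow> real^'n \<Rightarrow> real" where
  "merit t x = t * (f x + r x) + norm (c x)"

end

section \<open>The algorithm\<close>

text \<open>
  The sequences are the data of one run: \<open>\<tau>\<^sub>i\<^sub>n\<^sub>i\<^sub>t\<close> is the penalty parameter of index \<open>-1\<close>,
  \<open>i k\<close> is the backtracking exponent of the Cauchy point, and \<open>g\<^sub>r k\<close>, \<open>y k\<close>, \<open>z k\<close> are the chosen
  subgradient and multipliers of the subproblem. A run is required to satisfy the update rules at
  every index; the termination tests are kept apart in \<open>terminates_at\<close>, so an execution that does
  not terminate finitely is a run for which \<open>terminates_at\<close> never holds.
\<close>

locale proximal_algorithm = nonsmooth_nlp f g c J r
  for f :: "real^'n \<Rightarrow> real"
    and g :: "real^'n \<Rightarrow> real^'n"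
    and c :: "real^'n \<Rightarrow> real^'m"
    and J :: "real^'n \<Rightarrow> real^'n^'m"
    and r :: "real^'n \<Rightarrow> real" +
  fixes x\<^sub>0 :: "real^'n"
    and \<alpha>\<^sub>0 \<tau>\<^sub>i\<^sub>n\<^sub>i\<^sub>t \<kappa>\<^sub>v \<xi> \<eta>\<^sub>\<Phi> \<sigma>\<^sub>c \<epsilon>\<^sub>\<tau> \<gamma> \<eta>\<^sub>m :: real
    and x :: "nat \<Rightarrow> real^'n"
    and \<alpha> \<tau> :: "nat \<Rightarrow> real"
    and i :: "nat \<Rightarrow> nat"
    and v u s :: "nat \<Rightarrow> real^'n"
    and g\<^sub>r :: "nat \<Rightarrow> real^'n"
    and y :: "nat \<Rightarrow> real^'m"
    and z :: "nat \<Rightarrow> real^'n"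
begin

definition \<delta> :: "nat \<Rightarrow> real" where
  "\<delta> k = norm (closest_point (tangent_cone nonneg_orthant (x k)) (- (transpose (J (x k)) *v c (x k))))"

definition model :: "nat \<Rightarrow> real^'n \<Rightarrow> real" where
  "model k d = (1/2) * (norm (c (x k) + J (x k) *v d))\<^sup>2"

definition proj_step :: "nat \<Rightarrow> real \<Rightarrow> real^'n" where
  "proj_step k \<beta> = closest_point nonneg_orthant (x k - \<beta> *\<^sub>R (transpose (J (x k)) *v c (x k))) - x k"

text \<open>The vector \<open>transpose (J (x k)) *v c (x k)\<close> is the gradient of \<open>model k\<close> at \<open>0\<close>.\<close>

definition cauchy_test :: "nat \<Rightarrow> nat \<Rightarrow> bool" where
  "cauchy_test k j \<longleftrightarrow>
     norm (proj_step k (\<gamma> ^ j)) \<le> \<kappa>\<^sub>v * \<alpha> k * \<delta> k \<and>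
     model k (proj_step k (\<gamma> ^ j)) \<le>
       model k 0 + \<eta>\<^sub>m * ((transpose (J (x k)) *v c (x k)) \<bullet> proj_step k (\<gamma> ^ j))"

definition cauchy_point :: "nat \<Rightarrow> real^'n" where
  "cauchy_point k = proj_step k (\<gamma> ^ i k)"

definition subproblem_objective :: "nat \<Rightarrow> real^'n \<Rightarrow> real" where
  "subproblem_objective k d =
     g (x k) \<bullet> d + 1 / (2 * \<alpha> k) * (norm d)\<^sup>2 + 1 / \<alpha> k * (v k \<bullet> d) + r (x k + v k + d)"

definition subproblem_feasible :: "nat \<Rightarrow> real^'n \<Rightarrow> bool" where
  "subproblem_feasible k d \<longleftrightarrow> J (x k) *v d = 0 \<and> x k + v k + d \<in> nonneg_orthant"

definition A :: "nat \<Rightarrow> real" where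
  "A k = g (x k) \<bullet> s k + 1 / (2 * \<alpha> k) * (norm (s k))\<^sup>2 + r (x k + s k) - r (x k)"

definition infeasibility_reduction :: "nat \<Rightarrow> real" where
  "infeasibility_reduction k = norm (c (x k)) - norm (c (x k) + J (x k) *v s k)"

definition \<tau>_trial :: "nat \<Rightarrow> ereal" where
  "\<tau>_trial k = (if A k \<le> 0 then \<infinity> else ereal ((1 - \<sigma>\<^sub>c) * infeasibility_reduction k / A k))"

definition \<tau>_prev :: "nat \<Rightarrow> real" where
  "\<tau>_prev k = (case k of 0 \<Rightarrow> \<tau>\<^sub>i\<^sub>n\<^sub>i\<^sub>t | Suc j \<Rightarrow> \<tau> j)"

definition sufficient_decrease :: "nat \<Rightarrow> bool" where
  "sufficient_decrease k \<longleftrightarrow>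
     merit (\<tau> k) (x k + s k) - merit (\<tau> k) (x k) \<le>
       - \<eta>\<^sub>\<Phi> * (\<tau> k / (4 * \<alpha> k) * (norm (s k))\<^sup>2 + \<sigma>\<^sub>c * infeasibility_reduction k)"

definition terminates_at :: "nat \<Rightarrow> bool" where
  "terminates_at k \<longleftrightarrow> (\<delta> k = 0 \<and> c (x k) \<noteq> 0) \<or> s k = 0"

definition successful :: "nat set" where
  "successful = {k. x (Suc k) = x k + s k}"

definition standing_assumption :: bool where
  "standing_assumption \<longleftrightarrow>
     (\<exists>X. open X \<and> convex X \<and> (\<forall>k. x k \<in> X \<and> x k + v k \<in> X) \<and>
        bounded (f ` X) \<and> (\<forall>j. bounded ((\<lambda>w. c w $ j) ` X)) \<and>
        (\<exists>L. L-lipschitz_on X g) \<and> bounded (g ` X) \<and>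
        (\<forall>j. (\<exists>L. L-lipschitz_on X (\<lambda>w. J w $ j)) \<and> bounded ((\<lambda>w. J w $ j) ` X)) \<and>
        bounded (\<Union>w\<in>X. subdifferential r w))"

end

locale proximal_algorithm_run = proximal_algorithm +
  assumes x\<^sub>0_in: "x\<^sub>0 \<in> nonneg_orthant"
    and positive: "0 < \<alpha>\<^sub>0" "0 < \<tau>\<^sub>i\<^sub>n\<^sub>i\<^sub>t" "0 < \<kappa>\<^sub>v"
    and unit_interval: "{\<xi>, \<eta>\<^sub>\<Phi>, \<sigma>\<^sub>c, \<epsilon>\<^sub>\<tau>, \<gamma>, \<eta>\<^sub>m} \<subseteq> {0<..<1}"
    and init: "x 0 = x\<^sub>0" "\<alpha> 0 = \<alpha>\<^sub>0"
    and step1: "\<And>k. cauchy_test k (i k) \<and> (\<forall>j < i k. \<not> cauchy_test k j)"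
    and step2: "\<And>k. if \<delta> k = 0 then v k = 0
      else norm (v k) \<le> \<kappa>\<^sub>v * \<alpha> k * \<delta> k \<and> x k + v k \<in> nonneg_orthant \<and>
        model k (v k) \<le> model k (cauchy_point k)"
    \<comment> \<open>The objective is strongly convex, so its minimizer is unique.\<close>
    and step3: "\<And>k. is_arg_min (subproblem_objective k) (subproblem_feasible k) (u k)"
      "\<And>k. s k = v k + u k"
    and step3_multipliers: "\<And>k. g\<^sub>r k \<in> subdifferential r (x k + v k + u k)"
      "\<And>k. g (x k) + (1 / \<alpha> k) *\<^sub>R u k + (1 / \<alpha> k) *\<^sub>R v k + g\<^sub>r k +
        transpose (J (x k)) *v y k + z k = 0"
      "\<And>k. J (x k) *v u k = 0"
      "\<And>k. complementary (x k + v k + u k) (z k)"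
    and step5: "\<And>k. ereal (\<tau> k) =
      (if ereal (\<tau>_prev k) \<le> \<tau>_trial k then ereal (\<tau>_prev k)
       else min (ereal ((1 - \<epsilon>\<^sub>\<tau>) * \<tau>_prev k)) (\<tau>_trial k))"
    and step6: "\<And>k. if sufficient_decrease k
      then x (Suc k) = x k + s k \<and> \<alpha> (Suc k) = \<alpha> k
      else x (Suc k) = x k \<and> \<alpha> (Suc k) = \<xi> * \<alpha> k"

end

theory Submission
  imports Defs
begin

text \<open>
  Along \<open>S\<^sub>1\<close> the optimality conditions of the subproblem express the subgradient \<open>g\<^sub>r k\<close> at
  \<open>x (Suc k)\<close> through convergent quantities, and its limit lies in the relative interior of
  \<open>\<partial>r(x\<^sub>*)\<close>. So it suffices that points \<open>w\<close> near \<open>x\<^sub>*\<close> with a subgradient near a relative interior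
  point \<open>q\<close> lie in \<open>M\<close>. Otherwise move from such \<open>w\<close> along the normal space \<open>N\<close> at \<open>x\<^sub>*\<close> to a point
  \<open>p \<in> M\<close>, and let \<open>d \<in> N\<close> be a limit of the unit vectors \<open>(w - p) / \<parallel>w - p\<parallel>\<close>. Monotonicity of \<open>\<partial>r\<close>
  and its inner semicontinuity along \<open>M\<close> give \<open>(q - a) \<bullet> d \<ge> 0\<close> for all \<open>a \<in> \<partial>r(x\<^sub>*)\<close>. As \<open>q\<close> is a
  relative interior point, equality holds, so \<open>d\<close> is orthogonal to \<open>N\<close>, a contradiction.
\<close>

section \<open>Subgradients, relative interiors and normal spaces\<close>

lemma subdifferential_monotone:
  assumes "v \<in> subdifferential h x" "w \<in> subdifferential h y"
  shows "0 \<le> (v - w) \<bullet> (x - y)"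
proof -
  have "h x + v \<bullet> (y - x) \<le> h y" "h y + w \<bullet> (x - y) \<le> h x"
    using assms by (auto simp: subdifferential_def)
  then show ?thesis by (simp add: algebra_simps)
qed

lemma convex_subdifferential: "convex (subdifferential h x)"
proof -
  have "subdifferential h x = (\<Inter>y. {v. (y - x) \<bullet> v \<le> h y - h x})"
    by (auto simp: subdifferential_def inner_commute algebra_simps)
  then show ?thesis by (auto intro!: convex_INT convex_halfspace_le)
qed

text \<open>From any \<open>b\<close> in \<open>S\<close> the segment to \<open>q\<close> extends
  beyond \<open>q\<close> inside \<open>S\<close>. A value at \<open>b\<close> strictly below that
  at \<open>q\<close> would give a larger one at the extended point. The level set through
  \<open>q\<close> is affine, so equality passes to the hull.\<close>

lemma rel_interior_minimizer_inner_const: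
  fixes S :: "'a::euclidean_space set"
  assumes "convex S" "q \<in> rel_interior S" "a \<in> affine hull S"
    and le: "\<And>b. b \<in> S \<Longrightarrow> b \<bullet> d \<le> q \<bullet> d"
  shows "a \<bullet> d = q \<bullet> d"
proof -
  have "b \<bullet> d = q \<bullet> d" if b: "b \<in> S" for b
  proof -
    obtain e where e: "e > 1" "(1 - e) *\<^sub>R b + e *\<^sub>R q \<in> S"
      using convex_rel_interior_if2[OF assms(1,2)] hull_inc[OF b] by blast
    from le[OF e(2)] have "(e - 1) * (q \<bullet> d) \<le> (e - 1) * (b \<bullet> d)"
      by (simp add: inner_add_left algebra_simps)
    with e(1) have "q \<bullet> d \<le> b \<bullet> d" by simp
    with le[OF b] show ?thesis by simp
  qed
  then have "S \<subseteq> {b. d \<bullet> b = d \<bullet> q}" by (auto simp: inner_commute)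
  then have "affine hull S \<subseteq> {b. d \<bullet> b = d \<bullet> q}"
    by (rule hull_minimal) (rule affine_hyperplane)
  with assms(3) show ?thesis by (auto simp: inner_commute)
qed

text \<open>A subspace is its own double orthogonal complement, and the complement of this range is
  the kernel of \<open>D\<close>. Membership in the normal space thus becomes orthogonality to the
  tangent directions.\<close>

lemma range_adjoint_iff:
  fixes D :: "'a::euclidean_space \<Rightarrow> 'b::euclidean_space"
  assumes "linear D"
  shows "w \<in> range (adjoint D) \<longleftrightarrow> (\<forall>t. D t = 0 \<longrightarrow> t \<bullet> w = 0)"
proof -
  have "subspace (range (adjoint D))"
    using adjoint_linear[OF assms] linear_subspace_image subspace_UNIV by blast
  then have "range (adjoint D) = orthogonal_comp (orthogonal_comp (range (adjoint D)))"
    by (simp add: orthogonal_comp_self)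
  also have "orthogonal_comp (range (adjoint D)) = {t. D t = 0}"
    using ker_orthogonal_comp_adjoint[OF assms] by auto
  finally show ?thesis
    by (auto simp: orthogonal_comp_def orthogonal_def inner_commute)
qed

section \<open>Reaching the manifold by normal translations\<close>

text \<open>
  With \<open>P\<close> the orthogonal projection onto the kernel of \<open>D\<close>, the map \<open>G = D\<^sup>* F + P\<close> has an invertible
  derivative at \<open>x\<close>, and \<open>G p = P w\<close> says that \<open>p\<close> lies in \<open>M\<close> and that \<open>w - p\<close> is normal.
\<close>

lemma normal_translate_meets_manifold:
  assumes F: "local_defining_map M x F D" and x: "x \<in> M" and e: "e > 0"
  shows "\<forall>\<^sub>F w in nhds x. \<exists>p \<in> M \<inter> ball x e. w - p \<in> range (adjoint D)"
proof -
  obtain U V where U: "x \<in> U" "C2_on F U" "F ` U \<subseteq> V" "(F has_derivative D) (at x)" "range D = V"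
      "\<And>y. y \<in> U \<Longrightarrow> y \<in> M \<longleftrightarrow> F y = 0"
    using F unfolding local_defining_map_def by blast
  have "open U" and contF: "continuous_on U F"
    using U(2) unfolding C2_on_def
    by (blast, meson has_derivative_at_withinI has_derivative_continuous_on)
  have linD: "linear D" using U(4) has_derivative_linear by blast
  have adj: "t \<bullet> adjoint D w = D t \<bullet> w" for t w using linD by (simp add: adjoint_works)
  have linA: "bounded_linear (adjoint D)" using adjoint_linear[OF linD] linear_linear by blast
  have "subspace {t. D t = 0}" using linD by (rule linear_subspace_kernel)
  then obtain B where B: "B \<subseteq> {t. D t = 0}" "pairwise orthogonal B" "\<And>b. b \<in> B \<Longrightarrow> norm b = 1"
      "independent B" "span B = {t. D t = 0}"
    by (rule orthonormal_basis_subspace) blast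
  have "finite B" using B(4) by (rule independent_imp_finite)
  define P where "P w = (\<Sum>b\<in>B. (b \<bullet> w) *\<^sub>R b)" for w
  define G where "G w = adjoint D (F w) + P w" for w
  define G' where "G' w = adjoint D (D w) + P w" for w
  have linP: "bounded_linear P"
    unfolding P_def by (intro bounded_linear_sum bounded_linear_scaleR_const bounded_linear_inner_right)
  have innerP: "b \<bullet> P w = b \<bullet> w" if b: "b \<in> B" for b w
  proof -
    have "b \<bullet> P w = (\<Sum>b'\<in>B. if b' = b then b \<bullet> w else 0)"
      unfolding P_def inner_sum_right using b B(2,3)
      by (intro sum.cong) (auto simp: pairwise_def orthogonal_def dot_square_norm)
    then show ?thesis using b \<open>finite B\<close> by simp
  qed
  have DB: "D b = 0" if "b \<in> B" for b using B(1) that by blast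
  have PB: "P w = P w'" if "\<And>b. b \<in> B \<Longrightarrow> b \<bullet> w = b \<bullet> w'" for w w'
    unfolding P_def using that by simp
  \<comment> \<open>The summands lie in orthogonal spaces: pairing with \<open>b'\<close> in the
    kernel of \<open>D\<close> annihilates the first, and the coefficients of \<open>P\<close> are
    exactly these pairings.\<close>
  have sep: "adjoint D (D a) = 0 \<and> P b = P c" if "adjoint D (D a) + P b = P c" for a b c
  proof -
    have "b' \<bullet> b = b' \<bullet> c" if "b' \<in> B" for b'
      using arg_cong[OF \<open>adjoint D (D a) + P b = P c\<close>, of "\<lambda>t. b' \<bullet> t"] that
      by (simp add: inner_add_right adj DB innerP)
    then have "P b = P c" by (rule PB)
    with that show ?thesis by simp
  qed
  \<comment> \<open>Pairing with \<open>a\<close> gives the squared norm of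
    \<open>D a\<close>.\<close>
  have adjD: "D a = 0" if "adjoint D (D a) = 0" for a
    using adj[of a "D a"] that by simp
  have derG: "(G has_derivative G') (at x)"
    unfolding G_def[abs_def] G'_def[abs_def]
    by (intro has_derivative_add bounded_linear.has_derivative[OF linA] U(4)
        bounded_linear_imp_has_derivative linP)
  have linG': "linear G'" using derG has_derivative_linear by blast
  have P0: "P 0 = 0" by (simp add: P_def)
  have "inj G'"
  proof (subst linear_injective_0[OF linG'], intro allI impI)
    fix a assume "G' a = 0"
    then have "adjoint D (D a) + P a = P 0" by (simp add: G'_def P0)
    from sep[OF this] have "D a = 0" "P a = 0" using adjD P0 by auto
    then have "a \<in> span B" "\<And>b. b \<in> B \<Longrightarrow> orthogonal a b"
      using B(5) innerP by (auto simp: orthogonal_def) (metis inner_commute inner_zero_right)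
    then have "orthogonal a a" by (metis orthogonal_to_span)
    then show "a = 0" by (simp add: orthogonal_self)
  qed
  then obtain g' where g': "linear g'" "G' \<circ> g' = id"
    using linear_injective_isomorphism[OF linG'] by (auto simp: fun_eq_iff)
  define W where "W = U \<inter> ball x e"
  have "open W" "x \<in> W" using \<open>open U\<close> U(1) e by (auto simp: W_def)
  have "continuous_on U G"
    unfolding G_def using contF linA linP
    by (intro continuous_intros bounded_linear.continuous_on[OF linA]
        linear_continuous_on[OF linP]) auto
  \<comment> \<open>The derivative of \<open>G\<close> at \<open>x\<close> has the right inverse
    \<open>g'\<close>, so \<open>G\<close> maps neighbourhoods of \<open>x\<close> onto
    neighbourhoods of \<open>G x\<close>. As \<open>F x = 0\<close>, this point is
    \<open>P x\<close>, and continuity of \<open>P\<close> puts \<open>P w\<close> in the image for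
    all \<open>w\<close> near \<open>x\<close>.\<close>
  then have "G x \<in> interior (G ` W)"
    using \<open>open U\<close> U(1) derG g' \<open>open W\<close> \<open>x \<in> W\<close>
    by (intro sussmann_open_mapping[of U G x G' g'])
      (auto simp: W_def linear_linear interior_open)
  moreover have "G x = P x"
    using U(1,6) x linear_0[OF adjoint_linear[OF linD]] by (simp add: G_def)
  moreover have "(P \<longlongrightarrow> P x) (nhds x)"
    using linear_continuous_at[OF linP] by (simp add: isCont_def tendsto_nhds_iff)
  ultimately have "\<forall>\<^sub>F w in nhds x. P w \<in> interior (G ` W)"
    by (intro topological_tendstoD[of P "P x"]) auto
  then show ?thesis
  proof eventually_elim
    case (elim w)
    then obtain p where p: "p \<in> W" "P w = G p" using interior_subset by blast
    \<comment> \<open>The kernel of \<open>adjoint D\<close> meets \<open>range D\<close> only in 0,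
      so \<open>F p = 0\<close> can be recovered because \<open>F\<close> takes values in
      \<open>V = range D\<close>.\<close>
    then have "F p \<in> range D" using U(3,5) by (auto simp: W_def)
    then obtain a where a: "F p = D a" by blast
    have "adjoint D (D a) + P p = P w" using p a by (simp add: G_def)
    from sep[OF this] have *: "F p = 0" "P p = P w" using a adjD by auto
    then have "p \<in> M \<inter> ball x e" using p U(6) by (auto simp: W_def)
    moreover have "w - p \<in> range (adjoint D)"
    proof (subst range_adjoint_iff[OF linD], intro allI impI)
      fix t assume "D t = 0"
      then have "t \<in> span B" using B(5) by simp
      moreover have "orthogonal (w - p) b" if "b \<in> B" for b
        using innerP[OF that, of w] innerP[OF that, of p] *(2)
        by (simp add: orthogonal_def inner_diff_right inner_commute[of _ b])
      ultimately have "orthogonal (w - p) t" by (metis orthogonal_to_span)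
      then show "t \<bullet> (w - p) = 0" by (simp add: orthogonal_def inner_commute)
    qed
    ultimately show ?case by blast
  qed
qed

section \<open>Identification of the manifold\<close>

theorem partly_smooth_identification:
  fixes h :: "'a::euclidean_space \<Rightarrow> real"
  assumes h: "convex_on UNIV h" and ps: "partly_smooth h x M"
    and q: "q \<in> rel_interior (subdifferential h x)"
  shows "\<exists>e>0. \<forall>w q'. dist w x < e \<longrightarrow> dist q' q < e \<longrightarrow> q' \<in> subdifferential h w \<longrightarrow> w \<in> M"
proof (rule ccontr)
  assume neg: "\<not> ?thesis"
  have "x \<in> M" using ps by (simp add: partly_smooth_def C2_manifold_around_def)
  obtain N a\<^sub>0 where "is_normal_space M x N"
      and hull: "affine hull (subdifferential h x) = (\<lambda>w. a\<^sub>0 + w) ` N"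
    using ps by (auto simp: partly_smooth_def limiting_subdifferential_convex[OF h])
  then obtain F D where F: "local_defining_map M x F D" and N: "N = range (adjoint D)"
    by (auto simp: is_normal_space_def)
  have "linear D" using F has_derivative_linear by (auto simp: local_defining_map_def)
  then have subN: "subspace N"
    unfolding N using adjoint_linear linear_subspace_image subspace_UNIV by blast
  have "\<exists>w q' p. w \<notin> M \<and> q' \<in> subdifferential h w \<and> p \<in> M \<and> w - p \<in> N \<and>
      dist w x < inverse (real (Suc n)) \<and> dist q' q < inverse (real (Suc n)) \<and>
      dist p x < inverse (real (Suc n))" for n
  proof -
    define e where "e = inverse (real (Suc n))"
    have e: "e > 0" by (simp add: e_def)
    \<comment> \<open>Within radius \<open>d\<close> normal translates reach \<open>M\<close> inside
      the \<open>e\<close>-ball, so taking the failure at radius \<open>min d e\<close> controls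
      \<open>w\<close>, \<open>q'\<close> and \<open>p\<close> at once.\<close>
    from normal_translate_meets_manifold[OF F \<open>x \<in> M\<close> e] obtain d where d: "d > 0"
      "\<And>w. dist w x < d \<Longrightarrow> \<exists>p \<in> M \<inter> ball x e. w - p \<in> N"
      unfolding eventually_nhds_metric N by blast
    from neg e d(1) obtain w q' where wq: "dist w x < min d e" "dist q' q < min d e"
        "q' \<in> subdifferential h w" "w \<notin> M"
      by (metis min_less_iff_conj)
    with d(2) obtain p where "p \<in> M \<inter> ball x e" "w - p \<in> N" by (meson min_less_iff_conj)
    with wq show ?thesis
      by (fold e_def, intro exI[of _ w] exI[of _ q'] exI[of _ p]) (auto simp: dist_commute)
  qed
  then obtain w q' p where wqp: "\<And>n. w n \<notin> M" "\<And>n. q' n \<in> subdifferential h (w n)"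
      "\<And>n. p n \<in> M" "\<And>n. w n - p n \<in> N"
      "\<And>n. dist (w n) x < inverse (real (Suc n))" "\<And>n. dist (q' n) q < inverse (real (Suc n))"
      "\<And>n. dist (p n) x < inverse (real (Suc n))"
    by metis
  have lim: "X \<longlonglongrightarrow> l" if "\<And>n. dist (X n) l < inverse (real (Suc n))" for X :: "nat \<Rightarrow> 'a" and l
    using that by (intro tendstoI) (metis (mono_tags, lifting) LIMSEQ_inverse_real_of_nat
        order_tendstoD(2) eventually_mono order_less_trans)
  have limq: "q' \<longlonglongrightarrow> q" and limp: "p \<longlonglongrightarrow> x" using wqp by (auto intro: lim)
  define d where "d n = (w n - p n) /\<^sub>R norm (w n - p n)" for n
  have ne: "w n - p n \<noteq> 0" for n using wqp(1,3)[of n] by auto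
  then have "\<forall>n. d n \<in> sphere 0 1" by (auto simp: d_def)
  then obtain d\<^sub>0 \<rho> where d0: "d\<^sub>0 \<in> sphere 0 1" "strict_mono \<rho>" "(d \<circ> \<rho>) \<longlonglongrightarrow> d\<^sub>0"
    using compact_sphere[of "0::'a" 1] unfolding compact_def by metis
  have "d n \<in> N" for n unfolding d_def using wqp(4) subN by (simp add: subspace_scale)
  then have "d\<^sub>0 \<in> N" using closed_sequentially[OF closed_subspace[OF subN] _ d0(3)] by simp
  have "b \<bullet> d\<^sub>0 \<le> q \<bullet> d\<^sub>0" if b: "b \<in> subdifferential h x" for b
  proof -
    \<comment> \<open>Inner semicontinuity gives subgradients at \<open>p n\<close> only for large
      \<open>n\<close>. Their monotonicity inequality survives division by the norm and the limit
      along \<open>\<rho>\<close>.\<close>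
    obtain b' where b': "\<forall>\<^sub>F n in sequentially. b' n \<in> subdifferential h (p n)" "b' \<longlonglongrightarrow> b"
      using ps b wqp(3) limp
      unfolding partly_smooth_def setvalued_continuous_within_def limiting_subdifferential_convex[OF h]
      by blast
    have "\<forall>\<^sub>F n in sequentially. 0 \<le> (q' n - b' n) \<bullet> d n"
      using b'(1)
    proof eventually_elim
      case (elim n)
      from subdifferential_monotone[OF wqp(2) elim] show ?case by (simp add: d_def)
    qed
    then have "\<forall>\<^sub>F n in sequentially. 0 \<le> ((q' \<circ> \<rho>) n - (b' \<circ> \<rho>) n) \<bullet> (d \<circ> \<rho>) n"
      using eventually_subseq[OF d0(2)] by fastforce
    moreover have "(\<lambda>n. ((q' \<circ> \<rho>) n - (b' \<circ> \<rho>) n) \<bullet> (d \<circ> \<rho>) n) \<longlonglongrightarrow> (q - b) \<bullet> d\<^sub>0"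
      by (intro tendsto_intros d0(3) LIMSEQ_subseq_LIMSEQ[OF _ d0(2)] limq b'(2))
    ultimately have "0 \<le> (q - b) \<bullet> d\<^sub>0" by (intro tendsto_lowerbound) auto
    then show ?thesis by (simp add: inner_diff_left)
  qed
  then have "a \<bullet> d\<^sub>0 = q \<bullet> d\<^sub>0" if "a \<in> affine hull (subdifferential h x)" for a
    using rel_interior_minimizer_inner_const[OF convex_subdifferential q that] by blast
  \<comment> \<open>Both points lie in the translate of \<open>N\<close>; constancy of the pairing
    with \<open>d\<^sub>0\<close> then makes the squared norm of \<open>d\<^sub>0\<close>
    vanish.\<close>
  moreover have "a\<^sub>0 + 0 \<in> affine hull (subdifferential h x)"
    "a\<^sub>0 + d\<^sub>0 \<in> affine hull (subdifferential h x)"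
    unfolding hull using \<open>d\<^sub>0 \<in> N\<close> subspace_0[OF subN] by blast+
  ultimately have "(a\<^sub>0 + d\<^sub>0) \<bullet> d\<^sub>0 = (a\<^sub>0 + 0) \<bullet> d\<^sub>0" by metis
  then have "d\<^sub>0 = 0" by (simp add: inner_add_left)
  with d0(1) show False by simp
qed

section \<open>Passage to the limit along the iterates\<close>

lemma tendsto_transpose_matrix_vector_mult:
  fixes A :: "'b \<Rightarrow> real^'n^'m" and y :: "'b \<Rightarrow> real^'m"
  assumes "(A \<longlongrightarrow> A\<^sub>0) F" "(y \<longlongrightarrow> y\<^sub>0) F"
  shows "((\<lambda>k. transpose (A k) *v y k) \<longlongrightarrow> transpose A\<^sub>0 *v y\<^sub>0) F"
  unfolding matrix_vector_mult_def transpose_def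
  by (intro tendsto_vec_lambda, simp) (intro tendsto_intros assms)

theorem theorem5p27:
  fixes f :: "real^'n \<Rightarrow> real" and g :: "real^'n \<Rightarrow> real^'n"
    and c :: "real^'n \<Rightarrow> real^'m" and J :: "real^'n \<Rightarrow> real^'n^'m"
    and r :: "real^'n \<Rightarrow> real"
    and x\<^sub>0 :: "real^'n"
    and \<alpha>\<^sub>0 \<tau>\<^sub>i\<^sub>n\<^sub>i\<^sub>t \<kappa>\<^sub>v \<xi> \<eta>\<^sub>\<Phi> \<sigma>\<^sub>c \<epsilon>\<^sub>\<tau> \<gamma> \<eta>\<^sub>m :: real
    and x v u s g\<^sub>r z :: "nat \<Rightarrow> real^'n" and y :: "nat \<Rightarrow> real^'m"
    and \<alpha> \<tau> :: "nat \<Rightarrow> real" and i :: "nat \<Rightarrow> nat"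
    and x_star z_star :: "real^'n" and y_star :: "real^'m"
    and M :: "(real^'n) set" and S\<^sub>1 :: "nat set"
  assumes run: "proximal_algorithm_run f g c J r x\<^sub>0 \<alpha>\<^sub>0 \<tau>\<^sub>i\<^sub>n\<^sub>i\<^sub>t \<kappa>\<^sub>v \<xi> \<eta>\<^sub>\<Phi> \<sigma>\<^sub>c \<epsilon>\<^sub>\<tau> \<gamma> \<eta>\<^sub>m
      x \<alpha> \<tau> i v u s g\<^sub>r y z"
    and standing: "proximal_algorithm.standing_assumption f g c J r x v"
    and no_termination: "\<And>k. \<not> proximal_algorithm.terminates_at c J x s k"
    and kkt: "nonsmooth_nlp.kkt_point g c J r x_star y_star z_star"
    and partly_smooth: "partly_smooth r x_star M"
    and prox_param: "\<exists>a>0. \<forall>k. a \<le> \<alpha> k"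
    and S1: "infinite S\<^sub>1" "S\<^sub>1 \<subseteq> proximal_algorithm.successful x s"
    and limit: "((\<lambda>k. (x k, s k, y k, z k)) \<longlongrightarrow> (x_star, 0, y_star, z_star))
      (inf sequentially (principal S\<^sub>1))"
    and nondegenerate: "0 \<in> (\<lambda>w. (g x_star + transpose (J x_star) *v y_star + z_star) + w) `
      rel_interior (subdifferential r x_star)"
  shows "\<exists>K. \<forall>k \<in> S\<^sub>1. K \<le> k \<longrightarrow> x (Suc k) \<in> M"
proof -
  interpret proximal_algorithm_run f g c J r x\<^sub>0 \<alpha>\<^sub>0 \<tau>\<^sub>i\<^sub>n\<^sub>i\<^sub>t \<kappa>\<^sub>v \<xi> \<eta>\<^sub>\<Phi> \<sigma>\<^sub>c \<epsilon>\<^sub>\<tau> \<gamma> \<eta>\<^sub>m x \<alpha> \<tau> i v u s g\<^sub>r y z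
    by (rule run)
  let ?F = "inf sequentially (principal S\<^sub>1)"
  let ?q = "- (g x_star + transpose (J x_star) *v y_star + z_star)"
  have q: "?q \<in> rel_interior (subdifferential r x_star)"
    using nondegenerate unfolding image_iff by (metis neg_eq_iff_add_eq_0)
  have lim: "(x \<longlongrightarrow> x_star) ?F" "(s \<longlongrightarrow> 0) ?F" "(y \<longlongrightarrow> y_star) ?F" "(z \<longlongrightarrow> z_star) ?F"
    using tendsto_fst[OF limit] tendsto_fst[OF tendsto_snd[OF limit]]
      tendsto_fst[OF tendsto_snd[OF tendsto_snd[OF limit]]]
      tendsto_snd[OF tendsto_snd[OF tendsto_snd[OF limit]]] by simp_all
  obtain a where a: "a > 0" "\<And>k. a \<le> \<alpha> k" using prox_param by blast
  \<comment> \<open>The lower bound \<open>a\<close> on the proximal parameters keeps the factors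
    \<open>1 / \<alpha> k\<close> below \<open>1 / a\<close>, so the scaled steps vanish with the
    steps.\<close>
  have "((\<lambda>k. (1 / \<alpha> k) *\<^sub>R s k) \<longlongrightarrow> 0) ?F"
  proof (rule tendsto_0_le[OF lim(2), where K = "1 / a"], intro always_eventually allI)
    fix k
    have "1 / \<alpha> k \<le> 1 / a" "0 < \<alpha> k" using a(1) a(2)[of k] by (auto intro: divide_left_mono)
    then show "norm ((1 / \<alpha> k) *\<^sub>R s k) \<le> norm (s k) * (1 / a)"
      using mult_left_mono[of "1 / \<alpha> k" "1 / a" "norm (s k)"] by simp
  qed
  moreover have "((\<lambda>k. g (x k)) \<longlongrightarrow> g x_star) ?F" "((\<lambda>k. J (x k)) \<longlongrightarrow> J x_star) ?F"
    using continuous_on_tendsto_compose[OF g_cont lim(1)]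
      continuous_on_tendsto_compose[OF J_cont lim(1)] by simp_all
  ultimately have "((\<lambda>k. - (g (x k) + (1 / \<alpha> k) *\<^sub>R s k + transpose (J (x k)) *v y k + z k)) \<longlongrightarrow>
      - (g x_star + 0 + transpose (J x_star) *v y_star + z_star)) ?F"
    by (intro tendsto_intros tendsto_transpose_matrix_vector_mult lim)
  \<comment> \<open>Since \<open>s k = v k + u k\<close>, the two proximal terms of the stationarity
    condition merge, and the condition can be solved for \<open>g\<^sub>r k\<close>.\<close>
  moreover have "- (g (x k) + (1 / \<alpha> k) *\<^sub>R s k + transpose (J (x k)) *v y k + z k) = g\<^sub>r k" for k
  proof -
    have "(g (x k) + (1 / \<alpha> k) *\<^sub>R s k + transpose (J (x k)) *v y k + z k) + g\<^sub>r k = 0"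
      using step3_multipliers(2)[of k]
      by (simp only: step3(2) scaleR_add_right) (simp only: ac_simps)
    then show ?thesis by (rule minus_unique)
  qed
  ultimately have limq: "(g\<^sub>r \<longlongrightarrow> ?q) ?F" by simp
  have limx: "((\<lambda>k. x k + s k) \<longlongrightarrow> x_star) ?F"
    using tendsto_add[OF lim(1,2)] by simp
  obtain e where e: "e > 0" "\<And>w q'. dist w x_star < e \<Longrightarrow> dist q' ?q < e \<Longrightarrow>
      q' \<in> subdifferential r w \<Longrightarrow> w \<in> M"
    using partly_smooth_identification[OF r_convex partly_smooth q] by blast
  have "\<forall>\<^sub>F k in ?F. x k + s k \<in> M"
    using tendstoD[OF limx e(1)] tendstoD[OF limq e(1)]
  proof eventually_elim
    case (elim k)
    then show ?case using e(2) step3_multipliers(1)[of k] by (simp add: step3(2) add.assoc)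
  qed
  \<comment> \<open>Iterations in \<open>S\<^sub>1\<close> are successful, so there
    \<open>x k + s k\<close> is \<open>x (Suc k)\<close>.\<close>
  then show ?thesis
    using S1(2) unfolding eventually_inf_principal eventually_sequentially successful_def
    by (auto simp: subset_iff)
qed

end
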